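(* Let $n\ge r\ge 1$ be integers and let $G=V^1\vee V^2\vee\cdots\vee V^r$ be a join digraph of order $n$, where each $V^i$ is a weakly connected acyclic digraph on $n_i$ vertices, $n_1\ge\cdots\ge n_r\ge1$ and $\sum_{i=1}^r n_i=n$. Then: (i) $$LSM_3(G)\geq\sum_{i=1}^r\left[-n_i^4+(3n+6)n_i^3-(3n^2+12n+6)n_i^2+(n^3+6n^2+9n+4)n_i\right]-r(3n^2+3n+1)-\sum_{i=1}^rn_i\sum_{s\neq i}n_s(n-n_s-n_i),$$ with equality if and only if each $V^i$ is an in-tree. (ii) $$LSM_3(G)\leq\sum_{i=1}^r\left[-\frac{1}{4}n_i^4+\left(n+\frac{5}{2}\right)n_i^3-\left(\frac{3n^2}{2}+\frac{9n}{2}+\frac{1}{4}\right)n_i^2+\left(n^3+\frac{3n^2}{2}+\frac{n}{2}\right)n_i\right]-\sum_{i=1}^rn_i\sum_{s\neq i}n_s(n-n_s-n_i),$$ with equality if and only if each $V^i$ is a transitive tournament.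
   Context: All digraphs are finite, have no loops or multiple arcs, and are weakly connected (standing assumption). For a digraph $G$ with vertex set $\{v_1,\dots,v_n\}$, $d_i^+$ is the outdegree of $v_i$, $A(G)$ the adjacency matrix, $D^+(G)=\mathrm{diag}(d_1^+,\dots,d_n^+)$, and $L(G)=D^+(G)-A(G)$ the Laplacian matrix. For a nonnegative integer $k$, the $k$-th Laplacian spectral moment is $LSM_k(G)=\sum_{i=1}^n\lambda_i^k$, where $\lambda_i$ are the eigenvalues of $L(G)$ (so $LSM_3(G)=\mathrm{tr}(L(G)^3)$). A digraph is acyclic if it has no directed cycle. The join $G_1\vee G_2$ of vertex-disjoint digraphs has vertex set $\mathcal V(G_1)\cup\mathcal V(G_2)$ and arc set $\mathcal A(G_1)\cup\mathcal A(G_2)\cup\{(u,v),(v,u): u\in\mathcal V(G_1), v\in\mathcal V(G_2)\}$. An in-tree is a digraph whose underlying undirected graph is a tree and in which every vertex has outdegree at most one. A transitive tournament is an orientation of a complete graph such that $(u,v),(v,w)$ arcs imply $(u,w)$ is an arc. *)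

theory Defs
  imports
    "Graph_Theory.Graph_Theory"
    "Jordan_Normal_Form.Char_Poly"
    "HOL-Library.Complex_Order"
begin

text \<open>
  A digraph without multiple arcs is a \<^typ>\<open>'a pair_pre_digraph\<close>; the locale
  \<^locale>\<open>pair_digraph\<close> adds finiteness and absence of loops. Weak connectedness is
  \<^const>\<open>connected\<close>. The matrices of \<open>G\<close> are taken with respect to an enumeration
  \<open>vs\<close> of its vertices without repetition.
\<close>

definition adjacency_matrix :: "'a pair_pre_digraph \<Rightarrow> 'a list \<Rightarrow> complex mat" where
  "adjacency_matrix G vs = mat (length vs) (length vs)
     (\<lambda>(i, j). if (vs ! i, vs ! j) \<in> parcs G then 1 else 0)"

definition outdegree_matrix :: "'a pair_pre_digraph \<Rightarrow> 'a list \<Rightarrow> complex mat" where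
  "outdegree_matrix G vs = mat (length vs) (length vs)
     (\<lambda>(i, j). if i = j then of_nat (out_degree (with_proj G) (vs ! i)) else 0)"

definition laplacian_matrix :: "'a pair_pre_digraph \<Rightarrow> 'a list \<Rightarrow> complex mat" where
  "laplacian_matrix G vs = outdegree_matrix G vs - adjacency_matrix G vs"

text \<open>
  The eigenvalues \<open>\<lambda>\<^sub>1, \<dots>, \<lambda>\<^sub>n\<close>, with algebraic multiplicity, are the multiset of complex
  roots of the characteristic polynomial.
\<close>

definition LSM :: "nat \<Rightarrow> 'a pair_pre_digraph \<Rightarrow> 'a list \<Rightarrow> complex" where
  "LSM k G vs = (\<Sum>x\<in>#proots (char_poly (laplacian_matrix G vs)). x ^ k)"

text \<open>
  In a loopfree digraph, \<^const>\<open>pre_digraph.cycle\<close> is a directed cycle of length at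
  least two; pairs of opposite arcs count as cycles.
\<close>

definition acyclic_digraph :: "'a pair_pre_digraph \<Rightarrow> bool" where
  "acyclic_digraph G \<longleftrightarrow> \<not> (\<exists>p. pre_digraph.cycle (with_proj G) p)"

definition join_digraph ::
    "'a pair_pre_digraph \<Rightarrow> 'a pair_pre_digraph \<Rightarrow> 'a pair_pre_digraph" where
  "join_digraph G H = \<lparr> pverts = pverts G \<union> pverts H,
     parcs = parcs G \<union> parcs H \<union> pverts G \<times> pverts H \<union> pverts H \<times> pverts G \<rparr>"

text \<open>
  \<open>iterated_join V r\<close> is the join of \<open>V 1, \<dots>, V r\<close>. The empty digraph in the base case is
  neutral for the join.
\<close>

primrec iterated_join :: "(nat \<Rightarrow> 'a pair_pre_digraph) \<Rightarrow> nat \<Rightarrow> 'a pair_pre_digraph" where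
  "iterated_join V 0 = \<lparr> pverts = {}, parcs = {} \<rparr>"
| "iterated_join V (Suc k) = join_digraph (iterated_join V k) (V (Suc k))"

text \<open>
  The underlying undirected graph is represented by \<^const>\<open>mk_symmetric\<close>, which has both
  \<open>(u, v)\<close> and \<open>(v, u)\<close> for every edge. The cycles of the undirected graph are thus the
  cycles of length at least three: those of length two run back and forth along one edge.
  For this reason \<^const>\<open>tree\<close> cannot be used.
\<close>

definition underlying_tree :: "'a pair_pre_digraph \<Rightarrow> bool" where
  "underlying_tree G \<longleftrightarrow> connected (with_proj G) \<and>
     \<not> (\<exists>p. pre_digraph.cycle (with_proj (mk_symmetric (with_proj G))) p \<and> 3 \<le> length p)"

definition in_tree :: "'a pair_pre_digraph \<Rightarrow> bool" where
  "in_tree G \<longleftrightarrow> underlying_tree G \<and> (\<forall>v\<in>pverts G. out_degree (with_proj G) v \<le> 1)"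

definition tournament :: "'a pair_pre_digraph \<Rightarrow> bool" where
  "tournament G \<longleftrightarrow> pair_digraph G \<and>
     (\<forall>u\<in>pverts G. \<forall>v\<in>pverts G. u \<noteq> v \<longrightarrow> ((u, v) \<in> parcs G \<longleftrightarrow> (v, u) \<notin> parcs G))"

definition transitive_tournament :: "'a pair_pre_digraph \<Rightarrow> bool" where
  "transitive_tournament G \<longleftrightarrow> tournament G \<and> trans (parcs G)"

end

theory Submission
  imports Defs "Jordan_Normal_Form.Schur_Decomposition"
begin

text \<open>
  Write \<open>n\<^sub>i\<close> for the order of the part containing a vertex \<open>u\<close>, \<open>c = n - n\<^sub>i\<close>, and \<open>d\<close> for the
  outdegree of \<open>u\<close> inside its part. Expanding the trace of the cube of the Laplacian matrix and using that the parts have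
  no directed cycles, the third moment is the sum of \<open>(d + c)\<^sup>3 + 3 c\<^sup>2\<close> over all vertices, minus
  the number of triples from three different parts. So each part can be treated on its own.
  For the lower bound, \<open>(d + c)\<^sup>3 \<ge> c\<^sup>3 + d (3 c\<^sup>2 + 3 c + 1)\<close> with equality for \<open>d \<le> 1\<close> only, and a
  connected part has at least \<open>n\<^sub>i - 1\<close> arcs; since an acyclic part has a sink, \<open>d \<le> 1\<close> everywhere
  already forces exactly \<open>n\<^sub>i - 1\<close> arcs. For the upper bound, removing sources one by one shows that
  the outdegrees of an acyclic digraph are dominated by \<open>0, 1, \<dots>, n\<^sub>i - 1\<close>, with equality when every
  two vertices are adjacent.
\<close>

section \<open>Power sums of eigenvalues\<close>

lemma trace_mult_commute:
  fixes A B :: "'a :: comm_semiring_0 mat"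
  assumes "A \<in> carrier_mat n m" "B \<in> carrier_mat m n"
  shows "(\<Sum>i<n. (A * B) $$ (i, i)) = (\<Sum>i<m. (B * A) $$ (i, i))"
proof -
  have "(\<Sum>i<n. (A * B) $$ (i, i)) = (\<Sum>i<n. \<Sum>j<m. A $$ (i, j) * B $$ (j, i))"
    using assms by (intro sum.cong) (auto simp: scalar_prod_def atLeast0LessThan)
  also have "\<dots> = (\<Sum>j<m. \<Sum>i<n. B $$ (j, i) * A $$ (i, j))"
    by (subst sum.swap) (simp add: mult.commute)
  also have "\<dots> = (\<Sum>i<m. (B * A) $$ (i, i))"
    using assms by (intro sum.cong) (auto simp: scalar_prod_def atLeast0LessThan)
  finally show ?thesis .
qed

lemma upper_triangular_pow:
  fixes B :: "'a :: semiring_1 mat"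
  assumes B: "B \<in> carrier_mat n n" "upper_triangular B"
  shows "upper_triangular (B ^\<^sub>m k) \<and> (\<forall>i<n. (B ^\<^sub>m k) $$ (i, i) = (B $$ (i, i)) ^ k)"
proof (induction k)
  case 0
  then show ?case using B by auto
next
  case (Suc k)
  have C: "B ^\<^sub>m k \<in> carrier_mat n n" using B by simp
  have entry: "(B ^\<^sub>m Suc k) $$ (i, j) = (\<Sum>l<n. (B ^\<^sub>m k) $$ (i, l) * B $$ (l, j))"
    if "i < n" "j < n" for i j
    using that B C by (auto simp: scalar_prod_def atLeast0LessThan)
  have "(B ^\<^sub>m Suc k) $$ (i, j) = 0" if "j < i" "i < n" for i j
  proof -
    have "(B ^\<^sub>m k) $$ (i, l) * B $$ (l, j) = 0" if "l < n" for l
      using Suc B C \<open>j < i\<close> \<open>i < n\<close> that by (cases "l < i") (auto simp: upper_triangular_def)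
    then show ?thesis using entry that by simp
  qed
  moreover have "(B ^\<^sub>m Suc k) $$ (i, i) = (B $$ (i, i)) ^ Suc k" if "i < n" for i
  proof -
    have "(B ^\<^sub>m k) $$ (i, l) * B $$ (l, i) = (if l = i then (B $$ (i, i)) ^ Suc k else 0)" if "l < n" for l
      using Suc B C \<open>i < n\<close> that
      by (cases l i rule: linorder_cases) (auto simp: upper_triangular_def power_commutes)
    then have "(B ^\<^sub>m Suc k) $$ (i, i) = (\<Sum>l<n. if l = i then (B $$ (i, i)) ^ Suc k else 0)"
      using entry that by (simp del: pow_mat.simps)
    then show ?thesis using that by simp
  qed
  ultimately show ?case using B C by (auto simp: upper_triangular_def)
qed

text \<open>A Schur decomposition makes \<open>A\<close> similar to an upper triangular
  \<open>B\<close> whose diagonal lists the eigenvalues with multiplicity. The powers of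
  \<open>B\<close> carry the powers of these entries on their diagonals, and similarity preserves
  the trace.\<close>

lemma sum_proots_char_poly_power:
  fixes A :: "complex mat"
  assumes A: "A \<in> carrier_mat n n"
  shows "(\<Sum>x\<in>#proots (char_poly A). x ^ k) = (\<Sum>i<n. (A ^\<^sub>m k) $$ (i, i))"
proof -
  obtain es where es: "mset es = proots (char_poly A)"
    using ex_mset by blast
  \<comment> \<open>Over the complex numbers the polynomial splits, and being monic it has leading
    coefficient one.\<close>
  have lin: "char_poly A = (\<Prod>e\<leftarrow>es. [:- e, 1:])"
    using complex_poly_decompose_multiset[of "char_poly A"] degree_monic_char_poly[OF A]
    by (simp add: es[symmetric] prod_mset_prod_list flip: mset_map)
  obtain B P Q where S: "schur_decomposition A es = (B, P, Q)"
    by (cases "schur_decomposition A es") auto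
  from schur_decomposition[OF A lin S]
  have sim: "similar_mat_wit A B P Q" and tri: "upper_triangular B" and diag: "diag_mat B = es"
    by auto
  note w = similar_mat_witD2[OF A sim] pow_carrier_mat[OF similar_mat_witD2(5)[OF A sim], of k]
    similar_mat_wit_pow_id[OF sim, of k]
  note B = w(5)
  have "(\<Sum>i<n. (A ^\<^sub>m k) $$ (i, i)) = (\<Sum>i<n. (P * (B ^\<^sub>m k * Q)) $$ (i, i))"
    using w by (simp add: assoc_mult_mat[of _ n n _ n _ n])
  also have "\<dots> = (\<Sum>i<n. ((B ^\<^sub>m k * Q) * P) $$ (i, i))"
    using w by (intro trace_mult_commute) auto
  also have "(B ^\<^sub>m k * Q) * P = B ^\<^sub>m k"
    using w by (simp add: assoc_mult_mat[of _ n n _ n _ n])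
  also have "(\<Sum>i<n. (B ^\<^sub>m k) $$ (i, i)) = (\<Sum>i<n. (B $$ (i, i)) ^ k)"
    using upper_triangular_pow[OF B tri] by simp
  also have "\<dots> = (\<Sum>x\<leftarrow>es. x ^ k)"
    using B by (simp add: diag[symmetric] diag_mat_def sum_list_sum_nth atLeast0LessThan)
  also have "\<dots> = (\<Sum>x\<in>#proots (char_poly A). x ^ k)"
    by (simp add: es[symmetric] sum_mset_sum_list flip: mset_map)
  finally show ?thesis by simp
qed

section \<open>Outdegrees of acyclic digraphs\<close>

text \<open>A sum of nonnegative differences vanishes only if each of them does. This carries
  equality cases from single terms to sums, first over vertices and later over parts.\<close>

lemma sum_eq_sum_iff_pointwise:
  fixes f g :: "'b \<Rightarrow> real"
  assumes "finite A" "\<And>i. i \<in> A \<Longrightarrow> f i \<le> g i"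
  shows "sum f A = sum g A \<longleftrightarrow> (\<forall>i\<in>A. f i = g i)"
proof
  assume "sum f A = sum g A"
  then show "\<forall>i\<in>A. f i = g i"
    using sum_mono_inv[of f A g] assms by blast
qed (simp cong: sum.cong)

text \<open>Induction by deleting a source \<open>s\<close>. It has at most
  \<open>card S - 1\<close> successors in \<open>S\<close>, which accounts for the last term of the
  sum on the right. Equality there means arcs from \<open>s\<close> to all other vertices, and this
  is exactly what totality on \<open>S\<close> adds to totality on \<open>S - {s}\<close>.\<close>

lemma sum_outdegree_acyclic:
  fixes f :: "nat \<Rightarrow> real" and R :: "'a rel"
  assumes "finite S" and R: "acyclic R" and f: "strict_mono f"
  shows "(\<Sum>v\<in>S. f (card (R `` {v} \<inter> S))) \<le> (\<Sum>j<card S. f j) \<and>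
         ((\<Sum>v\<in>S. f (card (R `` {v} \<inter> S))) = (\<Sum>j<card S. f j) \<longleftrightarrow> total_on S R)"
  using \<open>finite S\<close>
proof (induction S rule: finite_psubset_induct)
  case (psubset S)
  show ?case
  proof (cases "S = {}")
    case True
    then show ?thesis by simp
  next
    case False
    have "acyclic (R \<inter> S \<times> S)"
      using R by (rule acyclic_subset) auto
    then have "wf (R \<inter> S \<times> S)"
      using \<open>finite S\<close> by (intro finite_acyclic_wf) auto
    \<comment> \<open>A minimal element of the well-founded relation has no predecessor in
      \<open>S\<close>, so it is a source.\<close>
    then obtain s where "s \<in> S" "\<And>y. (y, s) \<in> R \<inter> S \<times> S \<Longrightarrow> y \<notin> S"
      using wfE_min'[OF _ \<open>S \<noteq> {}\<close>] by metis
    then have s: "s \<in> S" "\<And>y. y \<in> S \<Longrightarrow> (y, s) \<notin> R"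
      by blast+
    let ?S = "S - {s}"
    have loop: "(s, s) \<notin> R"
      using s by auto
    have sub: "R `` {s} \<inter> S \<subseteq> ?S" using loop by auto
    have f_le: "f (card (R `` {s} \<inter> S)) \<le> f (card ?S)"
      using f sub \<open>finite S\<close> by (simp add: strict_mono_less_eq card_mono)
    have f_eq: "f (card (R `` {s} \<inter> S)) = f (card ?S) \<longleftrightarrow> (\<forall>v\<in>?S. (s, v) \<in> R)"
    proof -
      have "f (card (R `` {s} \<inter> S)) = f (card ?S) \<longleftrightarrow> card (R `` {s} \<inter> S) = card ?S"
        using f by (simp add: strict_mono_eq)
      also have "\<dots> \<longleftrightarrow> R `` {s} \<inter> S = ?S"
        using card_subset_eq[OF _ sub] \<open>finite S\<close> by (metis finite_Diff)
      also have "\<dots> \<longleftrightarrow> (\<forall>v\<in>?S. (s, v) \<in> R)"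
        using loop by auto
      finally show ?thesis .
    qed
    \<comment> \<open>No arc from \<open>S\<close> enters \<open>s\<close>, so its deletion leaves
      the other outdegrees unchanged.\<close>
    have "R `` {v} \<inter> S = R `` {v} \<inter> ?S" if "v \<in> ?S" for v
      using s that by auto
    then have sum_eq: "(\<Sum>v\<in>S. f (card (R `` {v} \<inter> S))) =
        f (card (R `` {s} \<inter> S)) + (\<Sum>v\<in>?S. f (card (R `` {v} \<inter> ?S)))"
      using \<open>finite S\<close> s(1) by (simp add: sum.remove)
    have card: "card S = Suc (card ?S)"
      using \<open>finite S\<close> s(1) by (rule card.remove)
    have IH: "(\<Sum>v\<in>?S. f (card (R `` {v} \<inter> ?S))) \<le> (\<Sum>j<card ?S. f j)"
      "(\<Sum>v\<in>?S. f (card (R `` {v} \<inter> ?S))) = (\<Sum>j<card ?S. f j) \<longleftrightarrow> total_on ?S R"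
      using psubset.IH[of ?S] s(1) by auto
    have "total_on S R \<longleftrightarrow> total_on ?S R \<and> (\<forall>v\<in>?S. (s, v) \<in> R)"
      using s by (fastforce simp: total_on_def)
    then show ?thesis
      using f_le f_eq IH unfolding sum_eq card sum.lessThan_Suc by auto
  qed
qed

text \<open>A vertex set is grown from a single vertex, one vertex at a time. Each new vertex is
  joined to the old set by some arc, so the number of arcs inside the set also rises by at least
  one.\<close>

lemma card_le_Suc_card_connected_rel:
  fixes R :: "'a rel"
  assumes "finite S" "S \<noteq> {}" and R: "R \<subseteq> S \<times> S"
    and conn: "\<And>u v. u \<in> S \<Longrightarrow> v \<in> S \<Longrightarrow> (u, v) \<in> (R \<union> R\<inverse>)\<^sup>*"
  shows "card S \<le> Suc (card R)"
proof -
  have finR: "finite R"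
    using R \<open>finite S\<close> by (meson finite_SigmaI finite_subset)
  have "\<exists>T\<subseteq>S. card T = Suc k \<and> Suc k \<le> Suc (card (R \<inter> T \<times> T))" if "k < card S" for k
    using that
  proof (induction k)
    case 0
    then obtain x where "x \<in> S" using \<open>S \<noteq> {}\<close> by auto
    then show ?case by (intro exI[of _ "{x}"]) auto
  next
    case (Suc k)
    then obtain T where T: "T \<subseteq> S" "card T = Suc k" "Suc k \<le> Suc (card (R \<inter> T \<times> T))"
      by auto
    have "finite T" using T \<open>finite S\<close> finite_subset by blast
    obtain u v where uv: "u \<in> T" "v \<in> S - T"
      using T Suc.prems by (metis card.empty nat.simps(3) ex_in_conv DiffI psubsetI psubset_imp_ex_mem less_irrefl)
    \<comment> \<open>Without an arc across the boundary of \<open>T\<close>, everything connected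
      to \<open>u\<close> would stay in \<open>T\<close>, contrary to the choice of
      \<open>v\<close>.\<close>
    have "\<exists>x y. x \<in> T \<and> y \<notin> T \<and> (x, y) \<in> R \<union> R\<inverse>"
    proof (rule ccontr)
      assume closed: "\<nexists>x y. x \<in> T \<and> y \<notin> T \<and> (x, y) \<in> R \<union> R\<inverse>"
      have "w \<in> T" if "(u, w) \<in> (R \<union> R\<inverse>)\<^sup>*" for w
        using that by (induction rule: rtrancl_induct) (use uv(1) closed in auto)
      then show False using conn[of u v] uv T by blast
    qed
    then obtain x y where xy: "x \<in> T" "y \<notin> T" "(x, y) \<in> R \<union> R\<inverse>" by blast
    then obtain e where e: "e \<in> R" "e \<notin> T \<times> T" "e \<in> insert y T \<times> insert y T"
      by auto
    have "Suc (card (R \<inter> T \<times> T)) = card (insert e (R \<inter> T \<times> T))"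
      using e finR by simp
    also have "\<dots> \<le> card (R \<inter> insert y T \<times> insert y T)"
      using e finR by (intro card_mono) auto
    finally have "Suc (card (R \<inter> T \<times> T)) \<le> card (R \<inter> insert y T \<times> insert y T)" .
    moreover have "y \<in> S" using xy R by auto
    ultimately show ?case
      using T \<open>finite T\<close> xy by (intro exI[of _ "insert y T"]) auto
  qed
  from this[of "card S - 1"] obtain T where "card S \<le> Suc (card (R \<inter> T \<times> T))"
    using \<open>finite S\<close> \<open>S \<noteq> {}\<close> by (auto simp: card_gt_0_iff)
  also have "card (R \<inter> T \<times> T) \<le> card R"
    using finR by (intro card_mono) auto
  finally show ?thesis by simp
qed

lemma card_rel_eq_sum_outdegree:
  assumes "finite S" "R \<subseteq> S \<times> S"
  shows "card R = (\<Sum>v\<in>S. card (R `` {v}))"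
proof -
  have "R = (SIGMA v:S. R `` {v})" using assms by auto
  moreover have "finite (R `` {v})" for v
    using assms by (meson finite_Image finite_SigmaI finite_subset)
  ultimately show ?thesis
    using card_SigmaI[OF \<open>finite S\<close>, of "\<lambda>v. R `` {v}"] by simp
qed

section \<open>Sums of shifted cubes of outdegrees: the lower estimate\<close>

lemma cube_shift_ge_linear:
  fixes c :: real
  assumes "0 \<le> c"
  shows "c ^ 3 + real d * (3 * c\<^sup>2 + 3 * c + 1) \<le> (real d + c) ^ 3 \<and>
    (c ^ 3 + real d * (3 * c\<^sup>2 + 3 * c + 1) = (real d + c) ^ 3 \<longleftrightarrow> d \<le> 1)"
proof -
  \<comment> \<open>The linear function interpolates the shifted cube at \<open>d = 0\<close> and
    \<open>d = 1\<close>, hence the first two factors. The third is positive because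
    \<open>c\<close> is nonnegative.\<close>
  have eq: "(real d + c) ^ 3 - (c ^ 3 + real d * (3 * c\<^sup>2 + 3 * c + 1)) =
      real d * (real d - 1) * (real d + 1 + 3 * c)"
    by (simp add: algebra_simps power2_eq_square power3_eq_cube)
  show ?thesis
  proof (cases "d \<le> 1")
    case True
    then have "d = 0 \<or> d = 1" by auto
    then show ?thesis using True eq by auto
  next
    case False
    then have "0 < real d * (real d - 1) * (real d + 1 + 3 * c)"
      using \<open>0 \<le> c\<close> by (intro mult_pos_pos) auto
    then show ?thesis using False eq by linarith
  qed
qed

text \<open>The bound \<open>l\<close> is the sum of the linear minorants when there are exactly
  \<open>card S - 1\<close> arcs. Connectedness gives at least that many, and the slope of the
  minorant is positive.\<close>

lemma sum_outdegree_cubed_ge: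
  fixes R :: "'a rel" and c :: real
  assumes fin: "finite S" "S \<noteq> {}" and R: "R \<subseteq> S \<times> S" "acyclic R"
    and conn: "\<And>u v. u \<in> S \<Longrightarrow> v \<in> S \<Longrightarrow> (u, v) \<in> (R \<union> R\<inverse>)\<^sup>*"
    and c: "0 \<le> c"
  defines "l \<equiv> real (card S) * c ^ 3 + (real (card S) - 1) * (3 * c\<^sup>2 + 3 * c + 1)"
  shows "l \<le> (\<Sum>v\<in>S. (real (card (R `` {v})) + c) ^ 3) \<and>
    (l = (\<Sum>v\<in>S. (real (card (R `` {v})) + c) ^ 3) \<longleftrightarrow> (\<forall>v\<in>S. card (R `` {v}) \<le> 1))"
proof -
  define d where "d v = card (R `` {v})" for v
  define k where "k = 3 * c\<^sup>2 + 3 * c + 1"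
  have k: "0 < k" using c unfolding k_def by (intro add_nonneg_pos) auto
  have edges: "card S \<le> Suc (\<Sum>v\<in>S. d v)"
    using card_le_Suc_card_connected_rel[OF fin R(1) conn] card_rel_eq_sum_outdegree[OF fin(1) R(1)]
    by (simp add: d_def)
  have "finite R" using R fin by (meson finite_SigmaI finite_subset)
  then have "wf (R\<inverse>)" using R by (intro finite_acyclic_wf_converse)
  \<comment> \<open>Minimality for the converse relation makes \<open>t\<close> a sink. It saves one
    arc in the count of \<open>le1\<close>.\<close>
  then obtain t where t: "t \<in> S" "\<And>y. y \<in> S \<Longrightarrow> (t, y) \<notin> R"
    using \<open>S \<noteq> {}\<close> by (metis converse_iff wfE_min ex_in_conv)
  have "R `` {t} = {}" using R t by auto
  then have dt: "d t = 0" by (simp add: d_def)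
  have le1: "Suc (\<Sum>v\<in>S. d v) \<le> card S" if "\<forall>v\<in>S. d v \<le> 1"
  proof -
    have "(\<Sum>v\<in>S. d v) = (\<Sum>v\<in>S - {t}. d v)"
      using fin t dt by (simp add: sum.remove)
    also have "\<dots> \<le> (\<Sum>v\<in>S - {t}. 1)"
      using that by (intro sum_mono) auto
    finally show ?thesis using card_Suc_Diff1[OF fin(1) t(1)] by simp
  qed
  let ?g = "\<lambda>v. (real (d v) + c) ^ 3" and ?h = "\<lambda>v. c ^ 3 + real (d v) * k"
  have gh: "?h v \<le> ?g v" "?h v = ?g v \<longleftrightarrow> d v \<le> 1" for v
    using cube_shift_ge_linear[OF c, of "d v"] by (auto simp: k_def)
  have h: "(\<Sum>v\<in>S. ?h v) = real (card S) * c ^ 3 + real (\<Sum>v\<in>S. d v) * k"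
    by (simp add: sum.distrib sum_distrib_right)
  have "real (card S) - 1 \<le> real (\<Sum>v\<in>S. d v)" using edges by linarith
  then have lh: "l \<le> (\<Sum>v\<in>S. ?h v)"
    unfolding h l_def k_def[symmetric] using k by (intro add_left_mono mult_right_mono) simp_all
  have hg: "(\<Sum>v\<in>S. ?h v) \<le> (\<Sum>v\<in>S. ?g v)"
    using gh by (intro sum_mono)
  have hg_eq: "(\<Sum>v\<in>S. ?h v) = (\<Sum>v\<in>S. ?g v) \<longleftrightarrow> (\<forall>v\<in>S. d v \<le> 1)"
    using sum_eq_sum_iff_pointwise[of S ?h ?g] gh fin by simp
  \<comment> \<open>Outdegrees of at most one thus make the estimate of the number of arcs sharp as
    well, so the equality case of \<open>?h\<close> against \<open>?g\<close> decides that of the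
    whole bound.\<close>
  have "l = (\<Sum>v\<in>S. ?h v)" if "\<forall>v\<in>S. d v \<le> 1"
  proof -
    have "real (card S) - 1 = real (\<Sum>v\<in>S. d v)" using edges le1[OF that] by linarith
    then show ?thesis unfolding h l_def k_def[symmetric] by simp
  qed
  then show ?thesis
    using lh hg hg_eq unfolding d_def by fastforce
qed

section \<open>From digraphs to arc relations: in-trees and transitive tournaments\<close>

lemma acyclic_rel_height:
  assumes "finite R" "acyclic R"
  obtains h :: "'a \<Rightarrow> nat" where "\<And>x y. (x, y) \<in> R \<Longrightarrow> h y < h x"
proof
  fix x y assume xy: "(x, y) \<in> R"
  \<comment> \<open>The height of a vertex is the number of vertices reachable from it by a nonempty
    walk. The inclusion is strict because \<open>y\<close> is reachable from \<open>x\<close> but,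
    by acyclicity, not from itself.\<close>
  have "R\<^sup>+ `` {y} \<subset> R\<^sup>+ `` {x}"
    using xy \<open>acyclic R\<close> by (auto simp: acyclic_def intro: trancl_into_trancl2)
  moreover have "finite (R\<^sup>+ `` {x})" using \<open>finite R\<close> by (simp add: finite_Image)
  ultimately show "card (R\<^sup>+ `` {y}) < card (R\<^sup>+ `` {x})"
    by (rule psubset_card_mono[rotated])
qed

text \<open>A pair \<open>(u, u)\<close> in the transitive closure yields a nonempty closed walk,
  and every such walk contains a cycle.\<close>

lemma acyclic_digraph_imp_acyclic:
  assumes "pair_wf_digraph G" "acyclic_digraph G"
  shows "acyclic (parcs G)"
proof -
  interpret pair_wf_digraph G by fact
  show ?thesis
    using \<open>acyclic_digraph G\<close> closed_w_imp_cycle reachable1_awalk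
    unfolding acyclic_digraph_def acyclic_def closed_w_def by (metis length_greater_0_conv with_proj_simps(3))
qed

lemma connected_imp_rtrancl:
  assumes "connected (with_proj G)" "u \<in> pverts G" "v \<in> pverts G"
  shows "(u, v) \<in> (parcs G \<union> (parcs G)\<inverse>)\<^sup>*"
proof -
  have "u \<rightarrow>\<^sup>*\<^bsub>with_proj (mk_symmetric (with_proj G))\<^esub> v"
    using assms by (auto simp: connected_def)
  then have "(u, v) \<in> (parcs (mk_symmetric (with_proj G)))\<^sup>*"
    unfolding reachable_def with_proj_simps by (rule rtrancl_on_rtranclI)
  moreover have "parcs (mk_symmetric (with_proj G)) = parcs G \<union> (parcs G)\<inverse>"
    by (auto simp: parcs_mk_symmetric)
  ultimately show ?thesis by simp
qed

lemma pawalk_verts_eq_map_snd: "pcas u p v \<Longrightarrow> tl (pawalk_verts u p) = map snd p"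
proof (induction p arbitrary: u)
  case (Cons e es)
  then show ?case by (cases es) auto
qed simp

lemma pcas_nth: "pcas u p v \<Longrightarrow> Suc i < length p \<Longrightarrow> fst (p ! Suc i) = snd (p ! i)"
proof (induction p arbitrary: u i)
  case (Cons e es)
  then show ?case by (cases i; cases es) auto
qed simp

lemma pcas_ends: "pcas u p v \<Longrightarrow> p \<noteq> [] \<Longrightarrow> fst (p ! 0) = u \<and> snd (p ! (length p - 1)) = v"
proof (induction p arbitrary: u)
  case (Cons e es)
  then show ?case by (cases es) auto
qed simp

lemma out_degree_with_proj:
  "out_degree (with_proj G) v = card (parcs G `` {v})"
proof -
  have "out_arcs (with_proj G) v = Pair v ` (parcs G `` {v})"
    by (auto simp: out_arcs_def)
  then show ?thesis
    by (simp add: out_degree_def card_image inj_on_def)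
qed

text \<open>On a cycle of the underlying graph, a vertex of maximal height would have arcs to both of
  its neighbours.\<close>

lemma in_tree_iff_outdegree_le_1:
  assumes "pair_digraph G" "connected (with_proj G)" "acyclic_digraph G"
  shows "in_tree G \<longleftrightarrow> (\<forall>v\<in>pverts G. card (parcs G `` {v}) \<le> 1)"
proof -
  interpret pair_digraph G by fact
  let ?R = "parcs G"
  have fin: "finite ?R" by (rule pair_finite_arcs)
  have "underlying_tree G" if le1: "\<forall>v\<in>pverts G. card (?R `` {v}) \<le> 1"
    unfolding underlying_tree_def
  proof (intro conjI notI)
    show "connected (with_proj G)" by fact
    assume "\<exists>p. pre_digraph.cycle (with_proj (mk_symmetric (with_proj G))) p \<and> 3 \<le> length p"
    then obtain u p where p: "3 \<le> length p" "pcas u p u" "distinct (tl (pawalk_verts u p))"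
      "set p \<subseteq> parcs (mk_symmetric (with_proj G))"
      by (auto simp: pre_digraph.cycle_def pre_digraph.awalk_def cas_with_proj_eq awalk_verts_with_proj_eq)
    obtain h where h: "\<And>x y. (x, y) \<in> ?R \<Longrightarrow> h y < (h x :: nat)"
      using acyclic_rel_height[OF fin acyclic_digraph_imp_acyclic] assms(3) pair_wf_digraph by metis
    define k where "k = length p"
    \<comment> \<open>The vertices of the cycle are the heads of its arcs. Reading the index modulo
      \<open>k\<close> lets the closing arc be treated like all others.\<close>
    define q where "q i = snd (p ! (i mod k))" for i
    have k: "3 \<le> k" "p \<noteq> []" using p by (auto simp: k_def)
    have inj: "i mod k = j mod k" if "q i = q j" for i j
    proof -
      have "distinct (map snd p)" using p pawalk_verts_eq_map_snd by metis
      moreover have "i mod k < length p" "j mod k < length p" using k by (simp_all add: k_def)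
      ultimately show ?thesis
        using that by (metis q_def distinct_conv_nth length_map nth_map)
    qed
    have step: "(q i, q (Suc i)) \<in> ?R \<union> ?R\<inverse>" for i
    proof -
      have "fst (p ! (Suc i mod k)) = q i"
      proof (cases "Suc (i mod k) = k")
        case True
        then have "i mod k = k - 1" "Suc i mod k = 0" by (auto simp: mod_Suc)
        then show ?thesis using pcas_ends[OF p(2) k(2)] by (simp add: q_def k_def)
      next
        case False
        then have "Suc i mod k = Suc (i mod k)" by (simp add: mod_Suc)
        moreover have "Suc (i mod k) < k" using False k by (simp add: Suc_lessI)
        ultimately show ?thesis using pcas_nth[OF p(2), of "i mod k"] by (simp add: q_def k_def)
      qed
      then have "p ! (Suc i mod k) = (q i, q (Suc i))" by (simp add: q_def prod_eq_iff)
      moreover have "p ! (Suc i mod k) \<in> set p" using k by (simp add: k_def)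
      ultimately show ?thesis using p(4) by (auto simp: parcs_mk_symmetric)
    qed
    have "Max ((h \<circ> q) ` {..<k}) \<in> (h \<circ> q) ` {..<k}"
      using k by (intro Max_in) (auto simp: lessThan_empty_iff)
    then obtain j where j: "h (q j) = Max ((h \<circ> q) ` {..<k})" by auto
    have q_mod: "q (i mod k) = q i" for i by (simp add: q_def)
    have max: "h (q i) \<le> h (q j)" for i
    proof -
      have "h (q (i mod k)) \<le> Max ((h \<circ> q) ` {..<k})"
        using k by (intro Max_ge) auto
      then show ?thesis using j q_mod by simp
    qed
    have qjk: "q (j + k) = q j" by (simp add: q_def)
    \<comment> \<open>The cyclic predecessor of position \<open>j\<close> is written
      \<open>j + k - 1\<close>, which avoids truncated subtraction at \<open>j = 0\<close>.\<close>
    have "(q (j + k - 1), q j) \<in> ?R \<union> ?R\<inverse>" "(q j, q (Suc j)) \<in> ?R \<union> ?R\<inverse>"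
      using step[of "j + k - 1"] step[of j] k qjk by simp_all
    then have "q (j + k - 1) \<in> ?R `` {q j}" "q (Suc j) \<in> ?R `` {q j}"
      using h max by (auto simp: not_less[symmetric])
    moreover have "card (?R `` {q j}) \<le> 1"
      using le1 calculation in_arcsD1 by auto
    ultimately have "q (j + k - 1) = q (Suc j)"
      using fin by (metis One_nat_def card_le_Suc0_iff_eq finite_Image)
    then have "(j + k - 1) mod k = Suc j mod k" by (rule inj)
    \<comment> \<open>The two neighbours of \<open>q j\<close> coincide, although their positions
      differ by \<open>k - 2\<close>. For \<open>k\<close> at least three this lies strictly between
      \<open>0\<close> and \<open>k\<close>, so \<open>k\<close> cannot divide it.\<close>
    then have "(Suc j + (k - 2)) mod k = Suc j mod k"
      using k by (simp add: Suc_diff_le numeral_2_eq_2 flip: add_Suc)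
    then have "k dvd k - 2"
      by (metis add_diff_cancel_left' mod_eq_dvd_iff_nat le_add1)
    then show False using k by (auto dest: dvd_imp_le)
  qed
  then show ?thesis
    unfolding in_tree_def by (auto simp: out_degree_with_proj)
qed

text \<open>This translates the equality case of \<open>sum_outdegree_acyclic\<close>. Given arcs
  from \<open>x\<close> to \<open>y\<close> and from \<open>y\<close> to \<open>z\<close>,
  acyclicity rules out the arc from \<open>z\<close> to \<open>x\<close>, and totality leaves only
  the one from \<open>x\<close> to \<open>z\<close>.\<close>

lemma transitive_tournament_iff_total_on:
  assumes "pair_digraph G" "acyclic_digraph G"
  shows "transitive_tournament G \<longleftrightarrow> total_on (pverts G) (parcs G)"
proof -
  interpret pair_digraph G by fact
  have acyc: "acyclic (parcs G)"
    using assms(2) pair_wf_digraph by (intro acyclic_digraph_imp_acyclic)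
  then have anti: "(v, u) \<notin> parcs G" if "(u, v) \<in> parcs G" for u v
    using that by (meson acyclic_def r_into_trancl' trancl_into_trancl)
  show ?thesis
  proof
    assume "transitive_tournament G"
    then show "total_on (pverts G) (parcs G)"
      unfolding transitive_tournament_def tournament_def total_on_def by blast
  next
    assume tot: "total_on (pverts G) (parcs G)"
    have "trans (parcs G)"
    proof (rule transI)
      fix x y z assume xyz: "(x, y) \<in> parcs G" "(y, z) \<in> parcs G"
      then have "(x, z) \<in> (parcs G)\<^sup>+" by (meson trancl.intros)
      then have "(z, x) \<notin> parcs G"
        using acyc by (auto simp: acyclic_def dest: trancl_into_trancl)
      moreover have "x \<noteq> z" using xyz anti by auto
      ultimately show "(x, z) \<in> parcs G"
        using tot xyz in_arcsD1 in_arcsD2 unfolding total_on_def by blast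
    qed
    then show "transitive_tournament G"
      using tot anti \<open>pair_digraph G\<close>
      unfolding transitive_tournament_def tournament_def total_on_def by blast
  qed
qed

section \<open>The third moment of a join\<close>

text \<open>This is the expansion of the trace of the cube of \<open>D - A\<close> for diagonal
  \<open>D\<close>. The terms with a single factor \<open>A\<close> vanish since \<open>A\<close>
  has zero diagonal, and cyclic invariance merges the three terms with two factors
  \<open>A\<close>.\<close>

lemma sum_triple_delta_minus:
  fixes a :: "'b \<Rightarrow> 'b \<Rightarrow> 'a :: comm_ring_1" and d :: "'b \<Rightarrow> 'a"
  assumes "finite S" and a: "\<And>u. u \<in> S \<Longrightarrow> a u u = 0"
  defines "l \<equiv> \<lambda>u v. (if u = v then d u else 0) - a u v"
  shows "(\<Sum>u\<in>S. \<Sum>v\<in>S. \<Sum>w\<in>S. l u v * l v w * l w u) =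
    (\<Sum>u\<in>S. d u ^ 3) + 3 * (\<Sum>u\<in>S. d u * (\<Sum>v\<in>S. a u v * a v u)) -
    (\<Sum>u\<in>S. \<Sum>v\<in>S. \<Sum>w\<in>S. a u v * a v w * a w u)"
proof -
  \<comment> \<open>\<open>P\<close> and \<open>M\<close> are the entries of the squares of
    \<open>A\<close> and of \<open>D - A\<close>.\<close>
  define P where "P v u = (\<Sum>w\<in>S. a v w * a w u)" for v u
  define M where "M v u = (\<Sum>w\<in>S. l v w * l w u)" for v u
  have left: "(\<Sum>w\<in>S. l v w * f w) = d v * f v - (\<Sum>w\<in>S. a v w * f w)" if "v \<in> S" for v f
  proof -
    have "(\<Sum>w\<in>S. l v w * f w) = (\<Sum>w\<in>S. (if v = w then d v * f v else 0) - a v w * f w)"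
      by (intro sum.cong) (auto simp: l_def algebra_simps)
    then show ?thesis using that \<open>finite S\<close> by (simp add: sum_subtractf)
  qed
  have right: "(\<Sum>w\<in>S. f w * l w u) = f u * d u - (\<Sum>w\<in>S. f w * a w u)" if "u \<in> S" for u f
  proof -
    have "(\<Sum>w\<in>S. f w * l w u) = (\<Sum>w\<in>S. (if w = u then f u * d u else 0) - f w * a w u)"
      by (intro sum.cong) (auto simp: l_def algebra_simps)
    then show ?thesis using that \<open>finite S\<close> by (simp add: sum_subtractf)
  qed
  have M: "M v u = d v * l v u - a v u * d u + P v u" if "v \<in> S" "u \<in> S" for v u
    using left[OF \<open>v \<in> S\<close>, of "\<lambda>w. l w u"] right[OF \<open>u \<in> S\<close>, of "a v"]
    by (simp add: M_def P_def)
  have inner: "(\<Sum>v\<in>S. l u v * M v u) = d u ^ 3 + d u * P u u +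
      (\<Sum>v\<in>S. a u v * a v u * d u) + (\<Sum>v\<in>S. a u v * a v u * d v) - (\<Sum>v\<in>S. a u v * P v u)"
    if "u \<in> S" for u
  proof -
    have "(\<Sum>v\<in>S. a u v * M v u) = (\<Sum>v\<in>S. a u v * P v u - a u v * a v u * d u - a u v * a v u * d v)"
      using that a by (intro sum.cong) (auto simp: M l_def algebra_simps)
    then show ?thesis
      using that a unfolding left[OF that]
      by (simp add: M l_def sum_subtractf power3_eq_cube algebra_simps)
  qed
  have swap: "(\<Sum>u\<in>S. \<Sum>v\<in>S. a u v * a v u * d v) = (\<Sum>u\<in>S. d u * P u u)"
    by (subst sum.swap) (simp add: P_def sum_distrib_left mult_ac)
  have diag: "(\<Sum>u\<in>S. \<Sum>v\<in>S. a u v * a v u * d u) = (\<Sum>u\<in>S. d u * P u u)"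
    by (simp add: P_def sum_distrib_left mult_ac)
  have "(\<Sum>u\<in>S. \<Sum>v\<in>S. \<Sum>w\<in>S. l u v * l v w * l w u) = (\<Sum>u\<in>S. \<Sum>v\<in>S. l u v * M v u)"
    by (simp add: M_def sum_distrib_left mult.assoc)
  also have "\<dots> = (\<Sum>u\<in>S. d u ^ 3) + 3 * (\<Sum>u\<in>S. d u * P u u) - (\<Sum>u\<in>S. \<Sum>v\<in>S. a u v * P v u)"
    using inner by (simp add: sum.distrib sum_subtractf swap diag)
  also have "(\<Sum>u\<in>S. \<Sum>v\<in>S. a u v * P v u) = (\<Sum>u\<in>S. \<Sum>v\<in>S. \<Sum>w\<in>S. a u v * a v w * a w u)"
    by (simp add: P_def sum_distrib_left mult.assoc)
  finally show ?thesis by (simp add: P_def)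
qed

lemma trace_mat_cubed:
  fixes A :: "'a :: comm_ring_1 mat"
  assumes A: "A \<in> carrier_mat n n"
  shows "(\<Sum>i<n. (A ^\<^sub>m 3) $$ (i, i)) = (\<Sum>i<n. \<Sum>j<n. \<Sum>k<n. A $$ (i, j) * A $$ (j, k) * A $$ (k, i))"
proof -
  have "A ^\<^sub>m 3 = A * (A * A)"
    using A by (simp add: eval_nat_numeral assoc_mult_mat[of _ n n _ n _ n])
  then show ?thesis
    using A by (auto simp: scalar_prod_def atLeast0LessThan sum_distrib_left mult.assoc intro!: sum.cong)
qed

text \<open>The indicator \<open>a\<close> is kept as a parameter that has to agree with the arcs on
  vertices only, so that a description of adjacency by parts can be substituted for it.\<close>

lemma LSM_3_eq:
  fixes G :: "'a pair_pre_digraph" and vs :: "'a list" and a :: "'a \<Rightarrow> 'a \<Rightarrow> real"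
  assumes "pair_wf_digraph G" and vs: "distinct vs" "set vs = pverts G"
    and loop: "\<And>u. (u, u) \<notin> parcs G"
    and a: "\<And>u v. u \<in> pverts G \<Longrightarrow> v \<in> pverts G \<Longrightarrow> a u v = of_bool ((u, v) \<in> parcs G)"
  defines "S \<equiv> pverts G"
  shows "LSM 3 G vs = complex_of_real
    ((\<Sum>u\<in>S. (\<Sum>v\<in>S. a u v) ^ 3) + 3 * (\<Sum>u\<in>S. (\<Sum>v\<in>S. a u v) * (\<Sum>v\<in>S. a u v * a v u)) -
    (\<Sum>u\<in>S. \<Sum>v\<in>S. \<Sum>w\<in>S. a u v * a v w * a w u))"
proof -
  define n where "n = length vs"
  define d where "d u = (\<Sum>v\<in>S. a u v)" for u
  define l where "l u v = (if u = v then d u else 0) - a u v" for u v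
  let ?L = "laplacian_matrix G vs"
  have finS: "finite S" unfolding S_def using vs by (metis List.finite_set)
  have L: "?L \<in> carrier_mat n n"
    by (auto simp: laplacian_matrix_def outdegree_matrix_def adjacency_matrix_def n_def)
  have deg: "real (out_degree (with_proj G) u) = d u" if "u \<in> S" for u
  proof -
    have "d u = (\<Sum>v\<in>S. of_bool ((u, v) \<in> parcs G))"
      unfolding d_def using that a by (intro sum.cong) (auto simp: S_def)
    moreover
    have "parcs G `` {u} = {v \<in> S. (u, v) \<in> parcs G}"
      using \<open>pair_wf_digraph G\<close> pair_wf_digraph.in_arcsD2 by (fastforce simp: S_def)
    ultimately show ?thesis
      using finS by (simp add: out_degree_with_proj of_bool_def sum.If_cases Int_def)
  qed
  have entry: "?L $$ (i, j) = complex_of_real (l (vs ! i) (vs ! j))" if "i < n" "j < n" for i j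
    using that vs deg[of "vs ! i", symmetric] a[of "vs ! i" "vs ! j"] nth_mem[of i vs] nth_mem[of j vs]
    by (auto simp: laplacian_matrix_def outdegree_matrix_def adjacency_matrix_def n_def l_def S_def nth_eq_iff_index_eq)
  have reindex: "(\<Sum>i<n. f (vs ! i)) = (\<Sum>u\<in>S. f u)" for f :: "'a \<Rightarrow> real"
    unfolding n_def S_def vs(2)[symmetric]
    by (intro sum.reindex_bij_betw bij_betw_nth vs) auto
  have "LSM 3 G vs = (\<Sum>i<n. \<Sum>j<n. \<Sum>k<n. ?L $$ (i, j) * ?L $$ (j, k) * ?L $$ (k, i))"
    unfolding LSM_def sum_proots_char_poly_power[OF L] by (rule trace_mat_cubed[OF L])
  also have "\<dots> = complex_of_real (\<Sum>i<n. \<Sum>j<n. \<Sum>k<n. l (vs ! i) (vs ! j) * l (vs ! j) (vs ! k) * l (vs ! k) (vs ! i))"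
    by (simp add: entry)
  also have "(\<Sum>i<n. \<Sum>j<n. \<Sum>k<n. l (vs ! i) (vs ! j) * l (vs ! j) (vs ! k) * l (vs ! k) (vs ! i)) =
      (\<Sum>u\<in>S. \<Sum>v\<in>S. \<Sum>w\<in>S. l u v * l v w * l w u)"
    by (simp only: reindex[of "\<lambda>w. l _ _ * l _ w * l w _"] reindex[of "\<lambda>v. \<Sum>w\<in>S. l _ v * l v w * l w _"]
        reindex[of "\<lambda>u. \<Sum>v\<in>S. \<Sum>w\<in>S. l u v * l v w * l w u"])
  also have "\<dots> = (\<Sum>u\<in>S. d u ^ 3) + 3 * (\<Sum>u\<in>S. d u * (\<Sum>v\<in>S. a u v * a v u)) -
    (\<Sum>u\<in>S. \<Sum>v\<in>S. \<Sum>w\<in>S. a u v * a v w * a w u)"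
    unfolding l_def by (rule sum_triple_delta_minus[OF finS]) (simp add: S_def a loop)
  finally show ?thesis by (simp add: d_def)
qed

section \<open>Vertices and arcs of the join, and sums over its parts\<close>

lemma pverts_iterated_join: "pverts (iterated_join V r) = (\<Union>i\<in>{1..r}. pverts (V i))"
  by (induction r) (auto simp: join_digraph_def atLeastAtMostSuc_conv)

lemma parcs_iterated_join:
  "(u, v) \<in> parcs (iterated_join V r) \<longleftrightarrow> (\<exists>i\<in>{1..r}. (u, v) \<in> parcs (V i)) \<or>
    (\<exists>i\<in>{1..r}. \<exists>j\<in>{1..r}. i \<noteq> j \<and> u \<in> pverts (V i) \<and> v \<in> pverts (V j))"
proof (induction r)
  case (Suc r)
  have neq: "Suc r \<noteq> i" if "i \<in> {1..r}" for i using that by auto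
  show ?case
    unfolding iterated_join.simps join_digraph_def pair_pre_digraph.simps Un_iff Suc.IH mem_Times_iff
      pverts_iterated_join
    using neq by (simp add: atLeastAtMostSuc_conv) blast
qed simp

lemma sum_partition:
  fixes F :: "nat \<Rightarrow> real"
  assumes "finite S" "finite I" "\<And>u. u \<in> S \<Longrightarrow> p u \<in> I"
  shows "(\<Sum>u\<in>S. F (p u)) = (\<Sum>i\<in>I. real (card {u \<in> S. p u = i}) * F i)"
proof -
  have "(\<Sum>u\<in>S. F (p u)) = (\<Sum>i\<in>I. \<Sum>u\<in>{u \<in> S. p u = i}. F (p u))"
    using assms by (subst sum.group) auto
  then show ?thesis by simp
qed

text \<open>\<open>R\<close> holds the arcs inside the parts \<open>{u. p u = i}\<close>; different parts are completely joined.\<close>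

lemma join_moment_sums:
  fixes p :: "'a \<Rightarrow> nat" and R :: "'a rel"
  assumes part: "\<And>u v. (u, v) \<in> R \<Longrightarrow> p u = p v"
    and no2: "\<And>u v. (u, v) \<in> R \<Longrightarrow> (v, u) \<notin> R"
    and no3: "\<And>u v w. (u, v) \<in> R \<Longrightarrow> (v, w) \<in> R \<Longrightarrow> (w, u) \<notin> R"
  defines "a \<equiv> \<lambda>u v. of_bool ((u, v) \<in> R \<or> p u \<noteq> p v) :: real"
    and "b \<equiv> \<lambda>u v. of_bool ((u, v) \<in> R) :: real"
    and "q \<equiv> \<lambda>u v. of_bool (p u \<noteq> p v) :: real"
  shows "(\<Sum>u\<in>S. (\<Sum>v\<in>S. a u v) ^ 3) + 3 * (\<Sum>u\<in>S. (\<Sum>v\<in>S. a u v) * (\<Sum>v\<in>S. a u v * a v u)) -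
      (\<Sum>u\<in>S. \<Sum>v\<in>S. \<Sum>w\<in>S. a u v * a v w * a w u) =
    (\<Sum>u\<in>S. ((\<Sum>v\<in>S. b u v) + (\<Sum>v\<in>S. q u v)) ^ 3 + 3 * (\<Sum>v\<in>S. q u v) ^ 2) -
      (\<Sum>u\<in>S. \<Sum>v\<in>S. \<Sum>w\<in>S. q u v * q v w * q w u)"
proof -
  define B where "B u = (\<Sum>v\<in>S. b u v)" for u
  define c where "c u = (\<Sum>v\<in>S. q u v)" for u
  have "a u v = b u v + q u v" for u v
    using part[of u v] by (auto simp: a_def b_def q_def)
  then have deg: "(\<Sum>v\<in>S. a u v) = B u + c u" for u
    by (simp add: B_def c_def sum.distrib)
  \<comment> \<open>Arcs inside a part are never reversed, so the 2-cycles are exactly the pairs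
    from different parts.\<close>
  have "a u v * a v u = q u v" for u v
    using no2[of u v] part[of u v] by (auto simp: a_def q_def)
  then have two: "(\<Sum>v\<in>S. a u v * a v u) = c u" for u
    by (simp add: c_def)
  \<comment> \<open>A directed triangle has at most one arc inside a part: two such arcs put all
    three vertices into the same part, where \<open>no3\<close> forbids the third arc. With one
    inner arc, both other pairs cross between the same two parts, so one factor \<open>q\<close>
    suffices.\<close>
  have "a u v * a v w * a w u = b u v * q v w + b v w * q w u + b w u * q u v + q u v * q v w * q w u"
    for u v w
    using part[of u v] part[of v w] part[of w u] no3[of u v w]
    by (auto simp: a_def b_def q_def)
  then have three: "(\<Sum>u\<in>S. \<Sum>v\<in>S. \<Sum>w\<in>S. a u v * a v w * a w u) =
      (\<Sum>u\<in>S. \<Sum>v\<in>S. \<Sum>w\<in>S. b u v * q v w) + (\<Sum>u\<in>S. \<Sum>v\<in>S. \<Sum>w\<in>S. b v w * q w u) +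
      (\<Sum>u\<in>S. \<Sum>v\<in>S. \<Sum>w\<in>S. b w u * q u v) + (\<Sum>u\<in>S. \<Sum>v\<in>S. \<Sum>w\<in>S. q u v * q v w * q w u)"
    by (simp add: sum.distrib)
  have bc: "b u v * c v = b u v * c u" for u v
    using part[of u v] by (auto simp: b_def c_def q_def)
  have one: "(\<Sum>u\<in>S. \<Sum>v\<in>S. \<Sum>w\<in>S. b u v * q v w) = (\<Sum>u\<in>S. B u * c u)"
    by (simp add: B_def bc sum_distrib_right flip: c_def sum_distrib_left)
  have rot: "(\<Sum>u\<in>S. \<Sum>v\<in>S. \<Sum>w\<in>S. g v w u) = (\<Sum>u\<in>S. \<Sum>v\<in>S. \<Sum>w\<in>S. g u v w)"
    for g :: "'a \<Rightarrow> 'a \<Rightarrow> 'a \<Rightarrow> real"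
  proof -
    have "(\<Sum>u\<in>S. \<Sum>v\<in>S. \<Sum>w\<in>S. g v w u) = (\<Sum>v\<in>S. \<Sum>u\<in>S. \<Sum>w\<in>S. g v w u)"
      by (rule sum.swap)
    also have "\<dots> = (\<Sum>u\<in>S. \<Sum>v\<in>S. \<Sum>w\<in>S. g u v w)"
      by (intro sum.cong refl sum.swap)
    finally show ?thesis .
  qed
  have rot1: "(\<Sum>u\<in>S. \<Sum>v\<in>S. \<Sum>w\<in>S. b v w * q w u) = (\<Sum>u\<in>S. B u * c u)"
    using rot[of "\<lambda>u v w. b u v * q v w"] one by simp
  have rot2: "(\<Sum>u\<in>S. \<Sum>v\<in>S. \<Sum>w\<in>S. b w u * q u v) = (\<Sum>u\<in>S. B u * c u)"
    using rot[of "\<lambda>u v w. b v w * q w u"] rot1 by simp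
  \<comment> \<open>The mixed sums from the 2-cycles cancel against the three equal sums from
    triangles with one inner arc, leaving only the squares of \<open>c\<close>.\<close>
  have "(\<Sum>u\<in>S. (B u + c u) * c u) = (\<Sum>u\<in>S. B u * c u) + (\<Sum>u\<in>S. (c u)\<^sup>2)"
    by (simp add: distrib_right sum.distrib power2_eq_square)
  then show ?thesis
    unfolding deg two three one rot1 rot2 unfolding B_def[symmetric] c_def[symmetric]
    by (simp add: sum.distrib flip: sum_distrib_left)
qed

text \<open>Once two different parts \<open>i\<close> and \<open>s\<close> are chosen, the third
  vertex may be any vertex outside both.\<close>

lemma sum_three_distinct_parts:
  fixes p :: "'a \<Rightarrow> nat"
  assumes fin: "finite S" "finite I" and p: "\<And>u. u \<in> S \<Longrightarrow> p u \<in> I"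
    and m: "\<And>i. i \<in> I \<Longrightarrow> card {u \<in> S. p u = i} = m i"
  defines "q \<equiv> \<lambda>u v. of_bool (p u \<noteq> p v) :: real"
  shows "(\<Sum>u\<in>S. \<Sum>v\<in>S. \<Sum>w\<in>S. q u v * q v w * q w u) =
    (\<Sum>i\<in>I. real (m i) * (\<Sum>s\<in>I - {i}. real (m s) * (real (card S) - real (m s) - real (m i))))"
proof -
  have part: "(\<Sum>u\<in>S. F (p u)) = (\<Sum>i\<in>I. real (m i) * F i)" for F :: "nat \<Rightarrow> real"
    using sum_partition[where F = F, OF fin p] m by simp
  have n: "real (card S) = (\<Sum>i\<in>I. real (m i))"
    using part[of "\<lambda>_. 1"] by simp
  have inner: "(\<Sum>t\<in>I. real (m t) * (of_bool (i \<noteq> s) * of_bool (s \<noteq> t) * of_bool (t \<noteq> i))) =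
      (if s = i then 0 else real (card S) - real (m s) - real (m i))"
    if "i \<in> I" "s \<in> I" for i s
  proof (cases "s = i")
    case False
    then have "(\<Sum>t\<in>I. real (m t) * (of_bool (i \<noteq> s) * of_bool (s \<noteq> t) * of_bool (t \<noteq> i))) =
        (\<Sum>t\<in>I. real (m t) - (if t = s then real (m s) else 0) - (if t = i then real (m i) else 0))"
      by (intro sum.cong) auto
    then show ?thesis using that False fin by (simp add: sum_subtractf n)
  qed simp
  have "(\<Sum>u\<in>S. \<Sum>v\<in>S. \<Sum>w\<in>S. q u v * q v w * q w u) =
      (\<Sum>i\<in>I. real (m i) * (\<Sum>s\<in>I. real (m s) *
        (\<Sum>t\<in>I. real (m t) * (of_bool (i \<noteq> s) * of_bool (s \<noteq> t) * of_bool (t \<noteq> i)))))"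
    unfolding q_def
    by (simp only: part[of "\<lambda>t. of_bool (_ \<noteq> _) * of_bool (_ \<noteq> t) * of_bool (t \<noteq> _)"]
        part[of "\<lambda>s. \<Sum>t\<in>I. real (m t) * (of_bool (_ \<noteq> s) * of_bool (s \<noteq> t) * of_bool (t \<noteq> _))"]
        part[of "\<lambda>i. \<Sum>s\<in>I. real (m s) * (\<Sum>t\<in>I. real (m t) * (of_bool (i \<noteq> s) * of_bool (s \<noteq> t) * of_bool (t \<noteq> i)))"])
  also have "\<dots> = (\<Sum>i\<in>I. real (m i) * (\<Sum>s\<in>I - {i}. real (m s) * (real (card S) - real (m s) - real (m i))))"
  proof (rule sum.cong[OF refl])
    fix i assume i: "i \<in> I"
    have "(\<Sum>s\<in>I. real (m s) *
        (\<Sum>t\<in>I. real (m t) * (of_bool (i \<noteq> s) * of_bool (s \<noteq> t) * of_bool (t \<noteq> i)))) =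
      (\<Sum>s\<in>I - {i}. real (m s) * (real (card S) - real (m s) - real (m i)))"
      using i fin by (simp add: inner sum.remove[of I i])
    then show "real (m i) * (\<Sum>s\<in>I. real (m s) *
        (\<Sum>t\<in>I. real (m t) * (of_bool (i \<noteq> s) * of_bool (s \<noteq> t) * of_bool (t \<noteq> i)))) =
      real (m i) * (\<Sum>s\<in>I - {i}. real (m s) * (real (card S) - real (m s) - real (m i)))"
      by simp
  qed
  finally show ?thesis .
qed

lemma sum_shifted_cubes:
  fixes c :: real
  shows "(\<Sum>j<k. (real j + c) ^ 3) = real k * c ^ 3 + 3 * c\<^sup>2 * (real k * (real k - 1) / 2) +
    3 * c * (real k * (real k - 1) * (2 * real k - 1) / 6) + (real k * (real k - 1) / 2)\<^sup>2"
  by (induction k) (auto simp: field_simps power2_eq_square power3_eq_cube)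

text \<open>The order on complex numbers compares real parts and demands equal imaginary parts, so
  the inequalities also say that the moment is real.\<close>

theorem theorem3p3:
  fixes V :: "nat \<Rightarrow> 'a pair_pre_digraph" and G :: "'a pair_pre_digraph"
    and n r :: nat and m :: "nat \<Rightarrow> nat" and vs :: "'a list"
  assumes "1 \<le> r" and "r \<le> n"
    and "\<And>i. i \<in> {1..r} \<Longrightarrow> pair_digraph (V i)"
    and "\<And>i. i \<in> {1..r} \<Longrightarrow> connected (with_proj (V i))"
    and "\<And>i. i \<in> {1..r} \<Longrightarrow> acyclic_digraph (V i)"
    and "\<And>i j. i \<in> {1..r} \<Longrightarrow> j \<in> {1..r} \<Longrightarrow> i \<noteq> j \<Longrightarrow> pverts (V i) \<inter> pverts (V j) = {}"
    and "\<And>i. i \<in> {1..r} \<Longrightarrow> card (pverts (V i)) = m i"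
    and "\<And>i j. 1 \<le> i \<Longrightarrow> i \<le> j \<Longrightarrow> j \<le> r \<Longrightarrow> m j \<le> m i"
    and "1 \<le> m r"
    and "(\<Sum>i = 1..r. m i) = n"
    and "G = iterated_join V r"
    and "card (pverts G) = n"
    and "distinct vs" and "set vs = pverts G"
  defines "lower \<equiv>
      (\<Sum>i = 1..r. - (real (m i) ^ 4) + (3 * real n + 6) * real (m i) ^ 3
          - (3 * real n ^ 2 + 12 * real n + 6) * real (m i) ^ 2
          + (real n ^ 3 + 6 * real n ^ 2 + 9 * real n + 4) * real (m i))
      - real r * (3 * real n ^ 2 + 3 * real n + 1)
      - (\<Sum>i = 1..r. real (m i) *
          (\<Sum>s\<in>{1..r} - {i}. real (m s) * (real n - real (m s) - real (m i))))"
    and "upper \<equiv>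
      (\<Sum>i = 1..r. - (1 / 4) * real (m i) ^ 4 + (real n + 5 / 2) * real (m i) ^ 3
          - (3 * real n ^ 2 / 2 + 9 * real n / 2 + 1 / 4) * real (m i) ^ 2
          + (real n ^ 3 + 3 * real n ^ 2 / 2 + real n / 2) * real (m i))
      - (\<Sum>i = 1..r. real (m i) *
          (\<Sum>s\<in>{1..r} - {i}. real (m s) * (real n - real (m s) - real (m i))))"
  shows "(LSM 3 G vs \<ge> complex_of_real lower \<and>
          (LSM 3 G vs = complex_of_real lower \<longleftrightarrow> (\<forall>i\<in>{1..r}. in_tree (V i)))) \<and>
         (LSM 3 G vs \<le> complex_of_real upper \<and>
          (LSM 3 G vs = complex_of_real upper \<longleftrightarrow> (\<forall>i\<in>{1..r}. transitive_tournament (V i))))"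
proof -
  note dig = assms(3) and conn = assms(4) and acyc = assms(5) and disj = assms(6)
    and card_V = assms(7) and G = assms(11) and card_G = assms(12) and vs = assms(13,14)
  define I where "I = {1..r}"
  define S where "S = pverts G"
  define R where "R = (\<Union>i\<in>I. parcs (V i))"
  have finI: "finite I" by (simp add: I_def)
  have wf: "pair_wf_digraph (V i)" if "i \<in> I" for i
    using dig that by (simp add: I_def pair_digraph.pair_wf_digraph)
  have arc: "u \<in> pverts (V i) \<and> v \<in> pverts (V i)" if "i \<in> I" "(u, v) \<in> parcs (V i)" for i u v
    using wf that by (metis pair_wf_digraph.in_arcsD1 pair_wf_digraph.in_arcsD2)
  have S: "S = (\<Union>i\<in>I. pverts (V i))"
    by (simp add: S_def G pverts_iterated_join I_def)
  have finS: "finite S" using vs by (metis List.finite_set S_def)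
  have "\<forall>u\<in>S. \<exists>i\<in>I. u \<in> pverts (V i)" by (simp add: S)
  then obtain p where p: "\<And>u. u \<in> S \<Longrightarrow> p u \<in> I" "\<And>u. u \<in> S \<Longrightarrow> u \<in> pverts (V (p u))"
    by metis
  have p_eq: "p u = i" if "i \<in> I" "u \<in> pverts (V i)" for i u
  proof -
    have "u \<in> S" using that S by blast
    then show ?thesis using p[of u] that disj[of i "p u"] unfolding I_def by blast
  qed
  have part: "{u \<in> S. p u = i} = pverts (V i)" if "i \<in> I" for i
    using p p_eq that by (auto simp: S)
  have card_part: "card {u \<in> S. p u = i} = m i" if "i \<in> I" for i
    using part card_V that by (simp add: I_def)
  have acycV: "acyclic (parcs (V i))" if "i \<in> I" for i
    using acyclic_digraph_imp_acyclic[OF wf[OF that]] acyc[of i] that by (simp add: I_def)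
  \<comment> \<open>By disjointness of the parts, an arc of \<open>R\<close> with one end in
    \<open>V i\<close> belongs to \<open>V i\<close>. Hence a directed 2-cycle or triangle in
    \<open>R\<close> would lie in a single part.\<close>
  have R_V: "(u, v) \<in> parcs (V i)" if "i \<in> I" "(u, v) \<in> R" "u \<in> pverts (V i) \<or> v \<in> pverts (V i)" for i u v
    using that arc p_eq unfolding R_def by (metis UN_E)
  have R_part: "p u = p v" if "(u, v) \<in> R" for u v
    using that arc p_eq unfolding R_def by (metis UN_E)
  have R_obtain: "\<exists>i\<in>I. (u, v) \<in> parcs (V i) \<and> u \<in> pverts (V i) \<and> v \<in> pverts (V i)" if "(u, v) \<in> R" for u v
    using that arc unfolding R_def by blast
  have no2: "(v, u) \<notin> R" if uv: "(u, v) \<in> R" for u v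
  proof
    assume "(v, u) \<in> R"
    then obtain i where "i \<in> I" "(u, v) \<in> parcs (V i)" "(v, u) \<in> parcs (V i)"
      using R_obtain[OF uv] R_V by blast
    then show False using acycV unfolding acyclic_def by (meson trancl.intros)
  qed
  have no3: "(w, u) \<notin> R" if uv: "(u, v) \<in> R" and vw: "(v, w) \<in> R" for u v w
  proof
    assume "(w, u) \<in> R"
    then obtain i where "i \<in> I" "(u, v) \<in> parcs (V i)" "(v, w) \<in> parcs (V i)" "(w, u) \<in> parcs (V i)"
      using R_obtain[OF uv] R_V vw by blast
    then show False using acycV unfolding acyclic_def by (meson trancl.intros)
  qed
  have arcs_G: "(u, v) \<in> parcs G \<longleftrightarrow> (u, v) \<in> R \<or> p u \<noteq> p v" if "u \<in> S" "v \<in> S" for u v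
  proof -
    have "(\<exists>i\<in>I. \<exists>j\<in>I. i \<noteq> j \<and> u \<in> pverts (V i) \<and> v \<in> pverts (V j)) \<longleftrightarrow> p u \<noteq> p v"
      using p[OF that(1)] p[OF that(2)] p_eq by metis
    then show ?thesis
      unfolding G parcs_iterated_join I_def[symmetric] by (simp add: R_def)
  qed
  have arcs_S: "u \<in> S \<and> v \<in> S" if "(u, v) \<in> parcs G" for u v
  proof -
    have "(\<exists>i\<in>I. u \<in> pverts (V i)) \<and> (\<exists>i\<in>I. v \<in> pverts (V i))"
      using that arc unfolding G parcs_iterated_join I_def[symmetric] by meson
    then show ?thesis by (simp add: S)
  qed
  have wfG: "pair_wf_digraph G"
    using arcs_S by unfold_locales (auto simp: S_def)
  have loop: "(u, u) \<notin> parcs G" for u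
    using arcs_G[of u u] arcs_S[of u u] no2[of u u] by blast
  \<comment> \<open>Every vertex of \<open>V i\<close> has arcs to all \<open>c i\<close> vertices
    outside \<open>V i\<close> and \<open>D i u\<close> arcs inside. \<open>T\<close> counts ordered
    triples from three different parts, and \<open>X i\<close> is what the vertices of
    \<open>V i\<close> contribute apart from \<open>T\<close>.\<close>
  define c where "c i = real n - real (m i)" for i
  define D where "D i u = card (parcs (V i) `` {u})" for i u
  define T where "T = (\<Sum>i\<in>I. real (m i) * (\<Sum>s\<in>I - {i}. real (m s) * (real n - real (m s) - real (m i))))"
  define X where "X i = (\<Sum>u\<in>pverts (V i). (real (D i u) + c i) ^ 3) + 3 * real (m i) * (c i)\<^sup>2" for i
  have finV: "finite (pverts (V i))" if "i \<in> I" for i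
    using finS S that by (metis UN_upper finite_subset)
  have q: "(\<Sum>v\<in>S. of_bool (p u \<noteq> p v)) = c (p u)" if "u \<in> S" for u
  proof -
    have "(\<Sum>v\<in>S. of_bool (p u \<noteq> p v) :: real) = (\<Sum>v\<in>S. 1 - of_bool (p v = p u))"
      by (intro sum.cong) auto
    also have "\<dots> = real (card S) - real (card {v \<in> S. p v = p u})"
      using finS by (simp add: sum_subtractf of_bool_def sum.If_cases Int_def)
    finally show ?thesis
      using part[OF p(1)[OF that]] card_V[of "p u"] p(1)[OF that] card_G by (simp add: c_def S_def I_def)
  qed
  have b: "(\<Sum>v\<in>S. of_bool ((u, v) \<in> R)) = real (D (p u) u)" if "u \<in> S" for u
  proof -
    have "v \<in> S \<and> (u, v) \<in> R \<longleftrightarrow> (u, v) \<in> parcs (V (p u))" for v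
      using R_V[of "p u" u v] arc[of "p u" u v] p[OF that] by (auto simp: S R_def)
    then have "{v \<in> S. (u, v) \<in> R} = parcs (V (p u)) `` {u}" by auto
    then show ?thesis
      using finS by (simp add: of_bool_def sum.If_cases Int_def D_def)
  qed
  have "LSM 3 G vs = complex_of_real ((\<Sum>u\<in>S. (real (D (p u) u) + c (p u)) ^ 3 + 3 * (c (p u))\<^sup>2) - T)"
  proof -
    have "real (card S) = real n" using card_G by (simp add: S_def)
    show ?thesis
    proof (rule trans[OF LSM_3_eq[OF wfG vs loop,
          where a = "\<lambda>u v. of_bool ((u, v) \<in> R \<or> p u \<noteq> p v)", folded S_def]], goal_cases)
      case (1 u v)
      then show ?case using arcs_G by simp
    next
      case 2
      show ?case
      proof (rule arg_cong[where f = complex_of_real], rule trans[OF join_moment_sums], goal_cases)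
        case (1 u v)
        then show ?case by (rule R_part)
      next
        case (2 u v)
        then show ?case by (rule no2)
      next
        case (3 u v w)
        then show ?case by (rule no3)
      next
        case 4
        show ?case
          using sum_three_distinct_parts[OF finS finI p(1) card_part]
          by (simp add: q b T_def \<open>real (card S) = real n\<close> cong: sum.cong)
      qed
    qed
  qed
  also have "(\<Sum>u\<in>S. (real (D (p u) u) + c (p u)) ^ 3 + 3 * (c (p u))\<^sup>2) = (\<Sum>i\<in>I. X i)"
  proof -
    have "(\<Sum>u\<in>S. (real (D (p u) u) + c (p u)) ^ 3 + 3 * (c (p u))\<^sup>2) =
        (\<Sum>i\<in>I. \<Sum>u\<in>{u \<in> S. p u = i}. (real (D (p u) u) + c (p u)) ^ 3 + 3 * (c (p u))\<^sup>2)"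
      using finS finI p(1) by (subst sum.group) auto
    also have "\<dots> = (\<Sum>i\<in>I. \<Sum>u\<in>pverts (V i). (real (D i u) + c i) ^ 3 + 3 * (c i)\<^sup>2)"
      using part p_eq by (simp cong: sum.cong)
    also have "\<dots> = (\<Sum>i\<in>I. X i)"
      using card_V by (intro sum.cong) (auto simp: X_def sum.distrib I_def)
    finally show ?thesis .
  qed
  finally have LSM: "LSM 3 G vs = complex_of_real ((\<Sum>i\<in>I. X i) - T)" .

  \<comment> \<open>These are the extreme values of \<open>X i\<close>: the minorant with
    \<open>m i - 1\<close> arcs, and the outdegrees \<open>0\<close> up to \<open>m i - 1\<close>.
    Substituting \<open>n - m i\<close> for \<open>c i\<close> gives the polynomials of the
    statement; the part of \<open>lo i\<close> free of \<open>m i\<close>, summed over the parts,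
    gives the term with factor \<open>r\<close>.\<close>
  define lo where "lo i = real (m i) * c i ^ 3 + (real (m i) - 1) * (3 * (c i)\<^sup>2 + 3 * c i + 1) +
    3 * real (m i) * (c i)\<^sup>2" for i
  define up where "up i = (\<Sum>j<m i. (real j + c i) ^ 3) + 3 * real (m i) * (c i)\<^sup>2" for i
  have lower: "lower = (\<Sum>i\<in>I. lo i) - T"
  proof -
    have "(\<Sum>i\<in>I. lo i) = (\<Sum>i\<in>I. (- (real (m i) ^ 4) + (3 * real n + 6) * real (m i) ^ 3
          - (3 * real n ^ 2 + 12 * real n + 6) * real (m i) ^ 2
          + (real n ^ 3 + 6 * real n ^ 2 + 9 * real n + 4) * real (m i)) - (3 * real n ^ 2 + 3 * real n + 1))"
      by (intro sum.cong refl) (simp add: lo_def c_def eval_nat_numeral algebra_simps)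
    then show ?thesis
      by (simp add: lower_def T_def I_def sum_subtractf)
  qed
  have upper: "upper = (\<Sum>i\<in>I. up i) - T"
  proof -
    have "(\<Sum>i\<in>I. up i) = (\<Sum>i\<in>I. - (1 / 4) * real (m i) ^ 4 + (real n + 5 / 2) * real (m i) ^ 3
          - (3 * real n ^ 2 / 2 + 9 * real n / 2 + 1 / 4) * real (m i) ^ 2
          + (real n ^ 3 + 3 * real n ^ 2 / 2 + real n / 2) * real (m i))"
      unfolding up_def sum_shifted_cubes c_def
      by (intro sum.cong refl) (simp add: eval_nat_numeral field_simps)
    then show ?thesis
      by (simp add: upper_def T_def I_def)
  qed
  have c_nonneg: "0 \<le> c i" if "i \<in> I" for i
  proof -
    have "pverts (V i) \<subseteq> S" using that S by auto
    then show ?thesis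
      using card_mono[OF finS, of "pverts (V i)"] card_V[of i] card_G[folded S_def] that
      by (simp add: c_def I_def)
  qed
  have lo: "lo i \<le> X i \<and> (lo i = X i \<longleftrightarrow> in_tree (V i))" if i: "i \<in> I" for i
  proof -
    have "pverts (V i) \<noteq> {}"
      using conn[of i] i by (auto simp: I_def connected_def strongly_connected_def)
    moreover have "parcs (V i) \<subseteq> pverts (V i) \<times> pverts (V i)"
      using arc[OF i] by auto
    ultimately show ?thesis
      using sum_outdegree_cubed_ge[OF finV[OF i] _ _ acycV[OF i] connected_imp_rtrancl c_nonneg[OF i]]
        in_tree_iff_outdegree_le_1[of "V i"] dig[of i] conn[of i] acyc[of i] card_V[of i] i
      by (simp add: lo_def X_def D_def I_def)
  qed
  have up: "X i \<le> up i \<and> (X i = up i \<longleftrightarrow> transitive_tournament (V i))" if i: "i \<in> I" for i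
  proof -
    have "strict_mono (\<lambda>j. (real j + c i) ^ 3)"
      using c_nonneg[OF i] by (intro strict_monoI power_strict_mono) auto
    moreover have "parcs (V i) `` {u} \<inter> pverts (V i) = parcs (V i) `` {u}" for u
      using arc[OF i] by auto
    ultimately show ?thesis
      using sum_outdegree_acyclic[OF finV[OF i] acycV[OF i], of "\<lambda>j. (real j + c i) ^ 3"]
        transitive_tournament_iff_total_on[of "V i"] dig[of i] acyc[of i] card_V[of i] i
      by (simp add: up_def X_def D_def I_def)
  qed
  \<comment> \<open>Since \<open>T\<close> is common to the moment and both bounds, only the sums of
    \<open>lo\<close>, \<open>X\<close> and \<open>up\<close> remain to be compared, part by
    part.\<close>
  have "sum lo I \<le> sum X I" "sum X I \<le> sum up I"
    using lo up by (auto intro: sum_mono)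
  moreover have "sum X I = sum lo I \<longleftrightarrow> (\<forall>i\<in>I. in_tree (V i))"
    using sum_eq_sum_iff_pointwise[of I lo X] lo finI by (simp add: eq_commute[of "sum X I"])
  moreover have "sum X I = sum up I \<longleftrightarrow> (\<forall>i\<in>I. transitive_tournament (V i))"
    using sum_eq_sum_iff_pointwise[of I X up] up finI by simp
  moreover have "complex_of_real x \<le> complex_of_real y \<longleftrightarrow> x \<le> y" for x y
    by (simp add: less_eq_complex_def)
  ultimately show ?thesis
    unfolding LSM lower upper I_def[symmetric] of_real_eq_iff
    by (simp del: of_real_diff of_real_sum)
qed

end
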